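(* For $n\ge1$ let $t_n(p,q):=\sum_{w\in\mathcal F_{n,2}}p^{\mathrm{sper}(P(w))}q^{\mathrm{area}(P(w))}$. Then for all $n\ge 3$, $$t_n(p,q)=pq\,t_{n-1}(p,q)+p^3q^3\,t_{n-2}(p,q),$$ with $t_1(p,q)=p^2q+p^3q^2$ and $t_2(p,q)=p^3q^2+2p^4q^3$. Moreover, for all $n\ge 1$, $$t_n(p,q)=\sum_{i=0}^{\lfloor (n+1)/2\rfloor}\binom{n+1-i}{i}p^{n+i+1}q^{n+i}.$$
   Context: $\mathcal F_{n,2}$ denotes the set of binary words $w=w_1\cdots w_n\in\{0,1\}^n$ with no two consecutive $1$'s (Fibonacci words). To $w$ one associates the bargraph polyomino $P(w)$: the union of the unit squares $[i-1,i]\times[j-1,j]$ for $1\le i\le n$, $1\le j\le w_i+1$. $\mathrm{area}(P)$ is the number of cells of $P$ and $\mathrm{sper}(P)$ is half of the perimeter of $P$. *)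

theory Defs
  imports Complex_Main "HOL-Library.Product_Plus"
begin

text \<open>\<open>\<F>\<^bsub>n,2\<^esub>\<close>; the letter \<open>w\<^sub>i\<close> is \<open>w ! (i - 1)\<close>.\<close>

definition fib_words :: "nat \<Rightarrow> nat list set" where
  "fib_words n = {w. length w = n \<and> set w \<subseteq> {0, 1} \<and>
     \<not> (\<exists>i. Suc i < length w \<and> w ! i = 1 \<and> w ! Suc i = 1)}"

text \<open>A polyomino is given by its set of cells, where \<open>(i, j)\<close> stands for the unit square
  \<open>[i - 1, i] \<times> [j - 1, j]\<close>.\<close>

type_synonym cell = "int \<times> int"

definition bargraph :: "nat list \<Rightarrow> cell set" where
  "bargraph w = {(int i, int j) | i j.
     1 \<le> i \<and> i \<le> length w \<and> 1 \<le> j \<and> j \<le> w ! (i - 1) + 1}"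

definition area :: "cell set \<Rightarrow> nat" where
  "area P = card P"

definition adjacent :: "cell \<Rightarrow> cell \<Rightarrow> bool" where
  "adjacent c d \<longleftrightarrow> \<bar>fst c - fst d\<bar> + \<bar>snd c - snd d\<bar> = 1"

text \<open>A unit segment of the boundary of \<open>P\<close> is the common side of a unique cell \<open>c\<close> of \<open>P\<close> and a
  unique cell \<open>d\<close> outside \<open>P\<close>, so the perimeter is the number of such pairs.\<close>

definition perimeter :: "cell set \<Rightarrow> nat" where
  "perimeter P = card {(c, d). c \<in> P \<and> d \<notin> P \<and> adjacent c d}"

text \<open>The division is exact for every polyomino: see \<open>two_times_sper\<close> below.\<close>

definition sper :: "cell set \<Rightarrow> nat" where
  "sper P = perimeter P div 2"

text \<open>Taking \<open>p\<close> and \<open>q\<close> in an arbitrary commutative semiring covers in particular the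
  indeterminates of a bivariate polynomial ring.\<close>

definition t_poly :: "nat \<Rightarrow> 'a::comm_semiring_1 \<Rightarrow> 'a \<Rightarrow> 'a" where
  "t_poly n p q = (\<Sum>w\<in>fib_words n. p ^ sper (bargraph w) * q ^ area (bargraph w))"

lemma finite_fib_words: "finite (fib_words n)"
  by (rule finite_subset[OF _ finite_lists_length_eq[of "{0, 1}" n]]) (auto simp: fib_words_def)

lemma finite_bargraph: "finite (bargraph w)"
proof -
  have "bargraph w \<subseteq> (\<Union>i\<in>{..length w}. \<Union>j\<in>{..w ! (i - 1) + 1}. {(int i, int j)})"
    by (auto simp: bargraph_def)
  then show ?thesis
    by (rule finite_subset) auto
qed

lemma card_leave_eq:
  fixes v :: cell
  assumes "finite P"
  shows "card {c \<in> P. c + v \<notin> P} = card {c \<in> P. c - v \<notin> P}"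
proof -
  have "bij_betw (\<lambda>c. c + v) {c \<in> P. c + v \<in> P} {c \<in> P. c - v \<in> P}"
    by (rule bij_betw_byWitness[where f' = "\<lambda>c. c - v"]) auto
  note same = bij_betw_same_card[OF this]
  have card_split: "card P = card {c \<in> P. f c \<in> P} + card {c \<in> P. f c \<notin> P}" for f :: "cell \<Rightarrow> cell"
  proof -
    have "P = {c \<in> P. f c \<in> P} \<union> {c \<in> P. f c \<notin> P}"
      by blast
    moreover have "card ({c \<in> P. f c \<in> P} \<union> {c \<in> P. f c \<notin> P}) =
        card {c \<in> P. f c \<in> P} + card {c \<in> P. f c \<notin> P}"
      using assms by (intro card_Un_disjoint) auto
    ultimately show ?thesis
      by simp
  qed
  have "card P = card {c \<in> P. c + v \<in> P} + card {c \<in> P. c + v \<notin> P}"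
    "card P = card {c \<in> P. c - v \<in> P} + card {c \<in> P. c - v \<notin> P}"
    by (rule card_split)+
  with same show ?thesis
    by linarith
qed

lemma adjacent_iff:
  "adjacent c d \<longleftrightarrow> d = c + (1, 0) \<or> d = c - (1, 0) \<or> d = c + (0, 1) \<or> d = c - (0, 1)"
  by (cases c; cases d) (auto simp: adjacent_def)

lemma perimeter_eq:
  assumes "finite P"
  shows "perimeter P = 2 * (card {c \<in> P. c + (1, 0) \<notin> P} + card {c \<in> P. c + (0, 1) \<notin> P})"
proof -
  define S where "S v = (\<lambda>c. (c, c + v)) ` {c \<in> P. c + v \<notin> P}" for v :: cell
  have card_S: "card (S v) = card {c \<in> P. c + v \<notin> P}" for v
    unfolding S_def by (rule card_image) (auto simp: inj_on_def)
  have fin: "finite (S v)" for v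
    using assms by (auto simp: S_def)
  have "{(c, d). c \<in> P \<and> d \<notin> P \<and> adjacent c d} = S (1, 0) \<union> S (- (1, 0)) \<union> S (0, 1) \<union> S (- (0, 1))"
    by (auto simp: S_def adjacent_iff)
  moreover have "S u \<inter> S v = {}" if "u \<noteq> v" for u v
    using that by (auto simp: S_def)
  ultimately have "perimeter P = card (S (1, 0)) + card (S (- (1, 0))) + card (S (0, 1)) + card (S (- (0, 1)))"
    unfolding perimeter_def by (simp add: card_Un_disjoint fin Int_Un_distrib2)
  then show ?thesis
    using card_leave_eq[OF assms, of "(1, 0)"] card_leave_eq[OF assms, of "(0, 1)"]
    unfolding card_S by (simp flip: diff_conv_add_uminus del: uminus_Pair)
qed

lemma two_times_sper: "finite P \<Longrightarrow> 2 * sper P = perimeter P"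
  by (simp add: sper_def perimeter_eq)

end

theory Submission
  imports Defs
begin

text \<open>The bargraph of a word has one top edge per column. In a nonempty Fibonacci word each letter 1 is
  followed by a 0 or ends the word, so every second-row cell carries a right edge; in the first row
  only the last cell does. If \<open>k\<close> is the number of letters 1, this gives area \<open>n + k\<close> and
  semiperimeter \<open>n + 1 + k\<close>. Hence \<open>t\<^sub>n = p\<^bsup>n+1\<^esup> q\<^bsup>n\<^esup> f\<^sub>n(p q)\<close>, where \<open>f\<^sub>n(x)\<close> is the sum of
  \<open>x\<^bsup>k\<^esup>\<close> over the words. Splitting words by the prefixes 0 and 10 yields
  \<open>f\<^bsub>n+2\<^esub> = f\<^bsub>n+1\<^esub> + x f\<^sub>n\<close>, which the diagonal binomial sums satisfy as well by Pascal's rule.\<close>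

section \<open>Cells and boundary edges of a bargraph\<close>

text \<open>Indexing from 0 makes column \<open>i\<close> the interval \<open>{..w ! i}\<close>, so
  counting and membership take place over naturals, without lower bounds.\<close>

lemma bargraph_eq_image:
  "bargraph w = (\<lambda>(i, j). (int (Suc i), int (Suc j))) ` (SIGMA i:{..<length w}. {..w ! i})"
proof (intro set_eqI iffI)
  fix c assume "c \<in> bargraph w"
  then obtain i j where ij: "c = (int i, int j)" "1 \<le> i" "i \<le> length w" "1 \<le> j" "j \<le> w ! (i - 1) + 1"
    by (auto simp: bargraph_def)
  then show "c \<in> (\<lambda>(i, j). (int (Suc i), int (Suc j))) ` (SIGMA i:{..<length w}. {..w ! i})"
    by (intro image_eqI[where x = "(i - 1, j - 1)"]) auto
next
  fix c assume "c \<in> (\<lambda>(i, j). (int (Suc i), int (Suc j))) ` (SIGMA i:{..<length w}. {..w ! i})"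
  then obtain i j where "c = (int (Suc i), int (Suc j))" "i < length w" "j \<le> w ! i"
    by auto
  then show "c \<in> bargraph w"
    unfolding bargraph_def by (intro CollectI exI[of _ "Suc i"] exI[of _ "Suc j"]) auto
qed

lemma mem_bargraph_iff:
  "(int (Suc i), int (Suc j)) \<in> bargraph w \<longleftrightarrow> i < length w \<and> j \<le> w ! i"
  by (auto simp: bargraph_eq_image)

lemma area_bargraph: "area (bargraph w) = length w + sum_list w"
proof -
  have "area (bargraph w) = card (SIGMA i:{..<length w}. {..w ! i})"
    unfolding area_def bargraph_eq_image by (rule card_image) (auto simp: inj_on_def)
  also have "\<dots> = length w + sum_list w"
    by (simp add: sum_list_sum_nth atLeast0LessThan sum_Suc)
  finally show ?thesis .
qed

lemma bargraph_cases:
  assumes "c \<in> bargraph w"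
  obtains i j where "c = (int (Suc i), int (Suc j))" "i < length w" "j \<le> w ! i"
  using assms by (auto simp: bargraph_eq_image)

text \<open>A column has no gaps, so only its highest cell has its upper neighbour outside.\<close>

lemma card_top_edges: "card {c \<in> bargraph w. c + (0, 1) \<notin> bargraph w} = length w"
proof -
  \<comment> \<open>Brings the translated cell into the shape to which
    \<open>mem_bargraph_iff\<close> applies.\<close>
  have step: "(int (Suc i), int (Suc j)) + (0, 1) = (int (Suc i), int (Suc (Suc j)))" for i j
    by simp
  have "{c \<in> bargraph w. c + (0, 1) \<notin> bargraph w}
      = (\<lambda>i. (int (Suc i), int (Suc (w ! i)))) ` {..<length w}" (is "?L = ?R")
  proof (intro set_eqI iffI)
    fix c assume c: "c \<in> ?L"
    then obtain i j where ij: "c = (int (Suc i), int (Suc j))" "i < length w" "j \<le> w ! i"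
      by (auto elim: bargraph_cases)
    with c have "\<not> Suc j \<le> w ! i"
      unfolding ij(1) step mem_Collect_eq mem_bargraph_iff by blast
    with ij have "j = w ! i" by simp
    with ij show "c \<in> ?R" by blast
  next
    fix c assume "c \<in> ?R"
    then show "c \<in> ?L"
      unfolding mem_Collect_eq by (elim imageE) (simp only: step mem_bargraph_iff, simp)
  qed
  moreover have "card ?R = length w"
    by (subst card_image) (auto simp: inj_on_def)
  ultimately show ?thesis by simp
qed

lemma fib_wordsD:
  assumes "w \<in> fib_words n"
  shows "length w = n" "i < n \<Longrightarrow> w ! i = 0 \<or> w ! i = 1"
    "Suc i < n \<Longrightarrow> w ! i = 1 \<Longrightarrow> w ! Suc i = 0"
proof -
  show len: "length w = n" using assms by (simp add: fib_words_def)
  have letter: "w ! i = 0 \<or> w ! i = 1" if "i < n" for i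
    using assms that nth_mem[of i w] unfolding fib_words_def by blast
  show "i < n \<Longrightarrow> w ! i = 0 \<or> w ! i = 1" by (rule letter)
  show "Suc i < n \<Longrightarrow> w ! i = 1 \<Longrightarrow> w ! Suc i = 0"
    using assms letter[of "Suc i"] by (auto simp: fib_words_def)
qed

lemma card_ones_fib_word:
  assumes "w \<in> fib_words n"
  shows "card {i. i < n \<and> w ! i = 1} = sum_list w"
proof -
  have "sum_list w = (\<Sum>i<n. w ! i)"
    using fib_wordsD(1)[OF assms] by (simp add: sum_list_sum_nth atLeast0LessThan)
  also have "\<dots> = (\<Sum>i<n. if w ! i = 1 then 1 else 0)"
    using fib_wordsD(2)[OF assms] by (intro sum.cong) auto
  also have "\<dots> = card {i. i < n \<and> w ! i = 1}"
    by (simp add: sum.If_cases Int_def)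
  finally show ?thesis ..
qed

lemma card_right_edges:
  assumes w: "w \<in> fib_words n" and n: "n \<ge> 1"
  shows "card {c \<in> bargraph w. c + (1, 0) \<notin> bargraph w} = Suc (sum_list w)"
proof -
  have step: "(int (Suc i), int (Suc j)) + (1, 0) = (int (Suc (Suc i)), int (Suc j))" for i j
    by simp
  let ?A = "{i. i < n \<and> w ! i = 1}"
  let ?R = "(\<lambda>i. (int (Suc i), int (Suc 1))) ` ?A"
  note fw = fib_wordsD[OF w]
  \<comment> \<open>The inserted cell is the bottom of the last column, which exists because
    \<open>n \<ge> 1\<close>; \<open>?R\<close> holds the second-row cells, one per letter
    1.\<close>
  have "{c \<in> bargraph w. c + (1, 0) \<notin> bargraph w} = insert (int (Suc (n - 1)), int (Suc 0)) ?R"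
    (is "?L = _")
  proof (intro set_eqI iffI)
    fix c assume c: "c \<in> ?L"
    then obtain i j where ij: "c = (int (Suc i), int (Suc j))" "i < n" "j \<le> w ! i"
      by (auto elim: bargraph_cases simp: fw(1))
    with c have no: "\<not> (Suc i < n \<and> j \<le> w ! Suc i)"
      unfolding ij(1) step mem_Collect_eq mem_bargraph_iff fw(1) by blast
    show "c \<in> insert (int (Suc (n - 1)), int (Suc 0)) ?R"
    proof (cases "j = 0")
      case True
      \<comment> \<open>Every column has a bottom cell, so one without a right neighbour lies in the
        last column.\<close>
      with no ij have "i = n - 1" by auto
      with True ij show ?thesis by simp
    next
      case False
      with ij fw(2)[of i] have "j = 1" "w ! i = 1" by auto
      with ij show ?thesis by blast
    qed
  next
    fix c assume "c \<in> insert (int (Suc (n - 1)), int (Suc 0)) ?R"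
    then consider "c = (int (Suc (n - 1)), int (Suc 0))"
      | i where "c = (int (Suc i), int (Suc 1))" "i < n" "w ! i = 1"
      by blast
    then show "c \<in> ?L"
    proof cases
      case 1
      then show ?thesis
        using n unfolding 1 step mem_Collect_eq mem_bargraph_iff fw(1) by simp
    next
      case 2
      \<comment> \<open>Either the word ends at \<open>i\<close> or the next letter is 0, and then
        the next column is too low.\<close>
      then show ?thesis
        using fw(3)[of i] unfolding 2(1) step mem_Collect_eq mem_bargraph_iff fw(1) by auto
    qed
  qed
  moreover have "card ?R = sum_list w"
    unfolding card_ones_fib_word[OF w, symmetric] by (rule card_image) (auto simp: inj_on_def)
  ultimately show ?thesis
    by (simp add: card_insert_if image_iff)
qed

lemma sper_bargraph_fib_word:
  assumes "w \<in> fib_words n" "n \<ge> 1"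
  shows "sper (bargraph w) = n + 1 + sum_list w"
  unfolding sper_def perimeter_eq[OF finite_bargraph] card_top_edges card_right_edges[OF assms]
  using fib_wordsD(1)[OF assms(1)] by simp

section \<open>Fibonacci words counted by their letters 1\<close>

text \<open>The positions of the 1's form an independent set of a path, so this is the independence
  polynomial of the path on \<open>n\<close> vertices.\<close>

definition fib_gf :: "nat \<Rightarrow> 'a::comm_semiring_1 \<Rightarrow> 'a" where
  "fib_gf n x = (\<Sum>w\<in>fib_words n. x ^ sum_list w)"

text \<open>At \<open>n = 0\<close> the two sides would be 1 and \<open>p\<close>, since the empty
  bargraph has semiperimeter 0.\<close>

lemma t_poly_eq_fib_gf:
  assumes "n \<ge> 1"
  shows "t_poly n p q = p ^ (n + 1) * q ^ n * fib_gf n (p * q)"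
  unfolding t_poly_def fib_gf_def sum_distrib_left
proof (rule sum.cong)
  fix w assume w: "w \<in> fib_words n"
  show "p ^ sper (bargraph w) * q ^ area (bargraph w) = p ^ (n + 1) * q ^ n * (p * q) ^ sum_list w"
    unfolding sper_bargraph_fib_word[OF w assms] area_bargraph fib_wordsD(1)[OF w]
    by (simp only: power_add power_mult_distrib mult.assoc mult.left_commute)
qed simp

text \<open>A pair of adjacent 1's either starts at the new letter or lies inside
  \<open>w\<close>.\<close>

lemma Cons_in_fib_words_iff:
  "a # w \<in> fib_words (Suc n) \<longleftrightarrow>
    w \<in> fib_words n \<and> (a = 0 \<or> a = 1 \<and> (w = [] \<or> w ! 0 = 0))"
proof -
  have "(\<exists>i. Suc i < length (a # w) \<and> (a # w) ! i = 1 \<and> (a # w) ! Suc i = 1) \<longleftrightarrow>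
    (w \<noteq> [] \<and> a = 1 \<and> w ! 0 = 1) \<or> (\<exists>i. Suc i < length w \<and> w ! i = 1 \<and> w ! Suc i = 1)"
    (is "(\<exists>i. ?P i) \<longleftrightarrow> _")
  proof -
    have "(\<exists>i. ?P i) \<longleftrightarrow> ?P 0 \<or> (\<exists>i. ?P (Suc i))"
      by (metis not0_implies_Suc)
    then show ?thesis by simp
  qed
  moreover have "w ! 0 = 0 \<or> w ! 0 = 1" if "w \<noteq> []" "set w \<subseteq> {0, 1}"
    using that by (cases w) auto
  ultimately show ?thesis
    unfolding fib_words_def by auto
qed

lemma fib_words_0: "fib_words 0 = {[]}"
  by (auto simp: fib_words_def)

lemma fib_words_1: "fib_words (Suc 0) = {[0], [1]}"
proof (rule set_eqI)
  fix w show "w \<in> fib_words (Suc 0) \<longleftrightarrow> w \<in> {[0], [1]}"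
  proof (cases w)
    case Nil
    then show ?thesis by (simp add: fib_words_def)
  next
    case (Cons a v)
    then show ?thesis by (auto simp: Cons_in_fib_words_iff fib_words_0)
  qed
qed

lemma fib_words_Suc_Suc:
  "fib_words (Suc (Suc n)) = (#) 0 ` fib_words (Suc n) \<union> (\<lambda>w. 1 # 0 # w) ` fib_words n"
proof (rule set_eqI)
  fix w
  show "w \<in> fib_words (Suc (Suc n)) \<longleftrightarrow>
    w \<in> (#) 0 ` fib_words (Suc n) \<union> (\<lambda>w. 1 # 0 # w) ` fib_words n"
  proof (cases "length w = Suc (Suc n)")
    case False
    then show ?thesis by (auto simp: fib_words_def)
  next
    case True
    then obtain a b v where "w = a # b # v"
      by (auto simp: length_Suc_conv)
    then show ?thesis by (auto simp: Cons_in_fib_words_iff image_iff)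
  qed
qed

lemma fib_gf_0: "fib_gf 0 x = 1"
  by (simp add: fib_gf_def fib_words_0)

lemma fib_gf_1: "fib_gf (Suc 0) x = 1 + x"
  by (simp add: fib_gf_def fib_words_1)

lemma fib_gf_Suc_Suc: "fib_gf (Suc (Suc n)) x = fib_gf (Suc n) x + x * fib_gf n x"
proof -
  have "fib_gf (Suc (Suc n)) x =
    (\<Sum>w\<in>(#) 0 ` fib_words (Suc n). x ^ sum_list w) +
    (\<Sum>w\<in>(\<lambda>w. 1 # 0 # w) ` fib_words n. x ^ sum_list w)"
    unfolding fib_gf_def fib_words_Suc_Suc
    by (rule sum.union_disjoint) (auto simp: finite_fib_words)
  \<comment> \<open>Prefixing is injective; the prefix 10 adds one letter 1, hence the factor
    \<open>x\<close>.\<close>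
  also have "\<dots> = fib_gf (Suc n) x + x * fib_gf n x"
    unfolding fib_gf_def by (simp add: sum.reindex inj_on_def sum_distrib_left)
  finally show ?thesis .
qed

section \<open>Diagonal sums of Pascal's triangle\<close>

text \<open>Summing up to \<open>n\<close> instead of \<open>n div 2\<close> adds only zeros and
  avoids parity cases in the recurrence.\<close>

definition diag_binomial_sum :: "nat \<Rightarrow> 'a::comm_semiring_1 \<Rightarrow> 'a" where
  "diag_binomial_sum n x = (\<Sum>i\<le>n. of_nat ((n - i) choose i) * x ^ i)"

lemma diag_binomial_sum_Suc:
  "diag_binomial_sum (Suc n) x = 1 + (\<Sum>j\<le>n. of_nat ((n - j) choose Suc j) * x ^ Suc j)"
  unfolding diag_binomial_sum_def by (subst sum.atMost_Suc_shift) simp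

lemma diag_binomial_sum_Suc_Suc:
  "diag_binomial_sum (Suc (Suc n)) x = diag_binomial_sum (Suc n) x + x * diag_binomial_sum n x"
proof -
  \<comment> \<open>The dropped term \<open>j = Suc n\<close> has coefficient
    \<open>0 choose Suc (Suc n)\<close>, which is 0.\<close>
  have "(\<Sum>j\<le>Suc n. of_nat ((Suc n - j) choose Suc j) * x ^ Suc j)
      = (\<Sum>j\<le>n. of_nat ((Suc n - j) choose Suc j) * x ^ Suc j)"
    by simp
  \<comment> \<open>Pascal's rule, as \<open>Suc n - j = Suc (n - j)\<close> for
    \<open>j \<le> n\<close>.\<close>
  also have "\<dots> = (\<Sum>j\<le>n. of_nat ((n - j) choose Suc j) * x ^ Suc j +
      x * (of_nat ((n - j) choose j) * x ^ j))"
    by (intro sum.cong) (auto simp: Suc_diff_le algebra_simps)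
  finally show ?thesis
    unfolding diag_binomial_sum_Suc[of "Suc n"] diag_binomial_sum_Suc[of n]
    by (simp add: diag_binomial_sum_def sum.distrib sum_distrib_left add.assoc)
qed

text \<open>The diagonal sums start 1, 1, \<open>1 + x\<close> and the word sums 1,
  \<open>1 + x\<close>, whence the shift by one.\<close>

lemma fib_gf_eq_diag_binomial_sum: "fib_gf n x = diag_binomial_sum (Suc n) x"
proof (induction n rule: induct_nat_012)
  case 0
  show ?case by (simp add: fib_gf_0 diag_binomial_sum_def)
next
  case 1
  show ?case by (simp add: fib_gf_1 diag_binomial_sum_def numeral_2_eq_2)
next
  case (ge2 n)
  then show ?case by (simp only: fib_gf_Suc_Suc diag_binomial_sum_Suc_Suc[of "Suc n"])
qed

text \<open>Beyond \<open>n div 2\<close> the upper index \<open>n - i\<close> is smaller than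
  \<open>i\<close>.\<close>

lemma diag_binomial_sum_eq_half:
  "diag_binomial_sum n x = (\<Sum>i = 0..n div 2. of_nat ((n - i) choose i) * x ^ i)"
  unfolding diag_binomial_sum_def
proof (rule sum.mono_neutral_right)
  show "\<forall>i\<in>{..n} - {0..n div 2}. of_nat ((n - i) choose i) * x ^ i = 0"
    by (auto simp: binomial_eq_0)
qed auto

theorem theorem1p3:
  fixes p q :: "'a::comm_semiring_1"
  shows "(\<forall>n\<ge>3. t_poly n p q = p * q * t_poly (n - 1) p q + p ^ 3 * q ^ 3 * t_poly (n - 2) p q) \<and>
    t_poly 1 p q = p ^ 2 * q + p ^ 3 * q ^ 2 \<and>
    t_poly 2 p q = p ^ 3 * q ^ 2 + 2 * p ^ 4 * q ^ 3 \<and>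
    (\<forall>n\<ge>1. t_poly n p q =
      (\<Sum>i = 0..(n + 1) div 2. of_nat ((n + 1 - i) choose i) * p ^ (n + i + 1) * q ^ (n + i)))"
proof (intro conjI allI impI)
  fix n :: nat assume "n \<ge> 3"
  then obtain m where n: "n = Suc (Suc (Suc m))"
    by (metis add_Suc le_Suc_ex numeral_3_eq_3 plus_nat.add_0)
  \<comment> \<open>Pulling out \<open>p ^ (n + 1) * q ^ n\<close> leaves the recurrence of
    \<open>fib_gf\<close> at \<open>x = p * q\<close>; \<open>n \<ge> 3\<close> makes all three
    indices positive.\<close>
  show "t_poly n p q = p * q * t_poly (n - 1) p q + p ^ 3 * q ^ 3 * t_poly (n - 2) p q"
    by (simp add: n t_poly_eq_fib_gf fib_gf_Suc_Suc[of "Suc m"] algebra_simps numeral_3_eq_3)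
next
  show "t_poly 1 p q = p ^ 2 * q + p ^ 3 * q ^ 2"
    by (simp add: t_poly_eq_fib_gf fib_gf_1 algebra_simps eval_nat_numeral)
next
  show "t_poly 2 p q = p ^ 3 * q ^ 2 + 2 * p ^ 4 * q ^ 3"
    by (simp add: t_poly_eq_fib_gf fib_gf_Suc_Suc fib_gf_1 fib_gf_0 algebra_simps mult_2_right eval_nat_numeral)
next
  fix n :: nat assume "n \<ge> 1"
  then have "t_poly n p q = p ^ (n + 1) * q ^ n *
      (\<Sum>i = 0..(n + 1) div 2. of_nat ((n + 1 - i) choose i) * (p * q) ^ i)"
    by (simp add: t_poly_eq_fib_gf fib_gf_eq_diag_binomial_sum diag_binomial_sum_eq_half)
  also have "\<dots> =
      (\<Sum>i = 0..(n + 1) div 2. of_nat ((n + 1 - i) choose i) * p ^ (n + i + 1) * q ^ (n + i))"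
    unfolding sum_distrib_left
    by (intro sum.cong refl) (simp add: power_add power_mult_distrib ac_simps)
  finally show "t_poly n p q =
      (\<Sum>i = 0..(n + 1) div 2. of_nat ((n + 1 - i) choose i) * p ^ (n + i + 1) * q ^ (n + i))" .
qed

end
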